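(* Let $n\ge 1$, and let $H_1\cong H_2\cong(\mathbb{C}^2)^{\otimes n}$. Let $(c_{ij})_{0\le i,j\le 4^n-1}$ be a real data table of two-time Pauli correlators, with associated operators $R=\frac{1}{4^n}\sum_{i,j}c_{ij}\,\sigma_i\otimes\sigma_j$ and $\bar R=\frac{1}{4^n}\sum_{i,j}c_{ij}\,\sigma_j\otimes\sigma_i=SRS^\dagger$, where $S$ is the swap operator. Put $\rho=\mathrm{Tr}_2R$ and $\gamma=\mathrm{Tr}_1R$ (so $\gamma=\mathrm{Tr}_2\bar R$), which are density matrices. Assume that the data were produced by a process with one of the two possible time orders, i.e. at least one of $R$, $\bar R$ is consistent with the forward time flow in the sense defined in the context. Suppose that $\rho$ and $\gamma$ are full rank, and let $M$ and $\bar M$ be the (then uniquely determined) operators extracted from $R$ and $\bar R$, that is, the solutions of $$R=\tfrac12\big((\rho\otimes\mathbb{1})M+M(\rho\otimes\mathbb{1})\big),\qquad \bar R=\tfrac12\big((\gamma\otimes\mathbb{1})\bar M+\bar M(\gamma\otimes\mathbb{1})\big).$$ If $M^{T_1}\ge 0$ while $\bar M^{T_1}\ge 0$ does not hold, then $R$ is the one of the two operators that is consistent with the forward time flow: $R$ is consistent with the forward time flow and $\bar R$ is not.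
   Context: Notation: $\{\sigma_i\}_{i=0}^{4^n-1}=\{\mathbb{1},\sigma_x,\sigma_y,\sigma_z\}^{\otimes n}$ are the $n$-qubit Pauli operators with $\sigma_0=\mathbb{1}$; $S=\sum_{k,l}|kl\rangle\langle lk|$ is the $n$-qubit swap operator; $T_1$ is the transpose (in the computational basis) on the first tensor factor; $\mathrm{Tr}_1,\mathrm{Tr}_2$ are the partial traces over the first and second tensor factors; $X\ge0$ means positive semidefinite. Origin of the data: an $n$-qubit system in a state at an initial time undergoes a completely positive trace-preserving (CPTP) map and is then observed at a final time. Pauli observables are measured at the two times, each via the projectors $\frac{\mathbb{1}\pm\sigma_i}{2}$ onto the $\pm1$ eigenspaces, and the expectation of the product of the outcomes is recorded. The experimenter records the correlators $c_{ij}$ ($\sigma_i$ measured at one time, $\sigma_j$ at the other) but not which of the two times is earlier. $R$ is the two-time pseudo-density matrix (PDM) obtained by assuming the first index is the earlier time, and $\bar R$ the one obtained by assuming the second index is the earlier time. Choi–Jamiołkowski (CJ) matrix: for a linear map $\mathcal{E}$ on $n$-qubit operators, its CJ matrix is $M_{\mathcal{E}}=\sum_{k,l=0}^{2^n-1}|k\rangle\langle l|\otimes\mathcal{E}(|l\rangle\langle k|)$. Every operator on the two-fold tensor product is the CJ matrix of a unique linear map, and $\mathcal{E}$ is completely positive iff $M_{\mathcal{E}}^{T_1}\ge0$. Closed form of the PDM: for an initial state $\omega$ (density matrix) and a CPTP map $\mathcal{E}$, the measurement scheme in which each Pauli observable $\sigma_i$ is measured at each of the two times via the projectors $\frac{\mathbb{1}\pm\sigma_i}{2}$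 onto its $\pm1$ eigenspaces gives the PDM $\frac12\big((\omega\otimes\mathbb{1})M_{\mathcal{E}}+M_{\mathcal{E}}(\omega\otimes\mathbb{1})\big)$, with the first tensor factor corresponding to the initial time. Consistency with the forward time flow: an operator $Q$ on the two-fold tensor product is consistent with the forward time flow if there is a CPTP map $\mathcal{E}$ such that $Q=\frac12\big((\omega\otimes\mathbb{1})M_{\mathcal{E}}+M_{\mathcal{E}}(\omega\otimes\mathbb{1})\big)$, where $\omega=\mathrm{Tr}_2Q$ is a density matrix. *)

theory Defs
  imports "Jordan_Normal_Form.Schur_Decomposition" "Jordan_Normal_Form.DL_Rank"
begin

section \<open>Matrix notions\<close>

text \<open>
  Matrices of a fixed size do not form a type of class \<open>comm_monoid_add\<close>, so \<open>sum\<close> is not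
  available for them; \<open>mat_sum nr nc f I\<close> is the entrywise sum of \<open>nr\<close> by \<open>nc\<close> matrices.
\<close>

definition mat_sum :: "nat \<Rightarrow> nat \<Rightarrow> ('i \<Rightarrow> complex mat) \<Rightarrow> 'i set \<Rightarrow> complex mat" where
  "mat_sum nr nc f I = mat nr nc (\<lambda>(r, s). \<Sum>i\<in>I. f i $$ (r, s))"

definition kron :: "complex mat \<Rightarrow> complex mat \<Rightarrow> complex mat" where
  "kron A B = mat (dim_row A * dim_row B) (dim_col A * dim_col B)
     (\<lambda>(r, s). A $$ (r div dim_row B, s div dim_col B) * B $$ (r mod dim_row B, s mod dim_col B))"

definition mat_trace :: "complex mat \<Rightarrow> complex" where
  "mat_trace A = (\<Sum>i<dim_row A. A $$ (i, i))"

text \<open>The order on complex numbers used here says that the value is real and nonnegative.\<close>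

definition psd :: "complex mat \<Rightarrow> bool" where
  "psd A \<longleftrightarrow> dim_row A = dim_col A \<and> mat_adjoint A = A \<and>
     (\<forall>v \<in> carrier_vec (dim_row A). 0 \<le> (A *\<^sub>v v) \<bullet>c v)"

definition density_matrix :: "nat \<Rightarrow> complex mat \<Rightarrow> bool" where
  "density_matrix d w \<longleftrightarrow> w \<in> carrier_mat d d \<and> psd w \<and> mat_trace w = 1"

text \<open>\<open>ketbra d k l\<close> is the matrix unit $|k\rangle\langle l|$.\<close>

definition ketbra :: "nat \<Rightarrow> nat \<Rightarrow> nat \<Rightarrow> complex mat" where
  "ketbra d k l = mat d d (\<lambda>(i, j). if i = k \<and> j = l then 1 else 0)"


section \<open>Two tensor factors of dimension d\<close>

text \<open>
  As in \<open>kron\<close>, the basis vector $|k\rangle\otimes|l\rangle$ has index \<open>k * d + l\<close>.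
\<close>

definition partial_trace1 :: "nat \<Rightarrow> complex mat \<Rightarrow> complex mat" where
  "partial_trace1 d X = mat d d (\<lambda>(i, j). \<Sum>k<d. X $$ (k * d + i, k * d + j))"

definition partial_trace2 :: "nat \<Rightarrow> complex mat \<Rightarrow> complex mat" where
  "partial_trace2 d X = mat d d (\<lambda>(i, j). \<Sum>k<d. X $$ (i * d + k, j * d + k))"

definition partial_transpose1 :: "nat \<Rightarrow> complex mat \<Rightarrow> complex mat" where
  "partial_transpose1 d X = mat (d * d) (d * d)
     (\<lambda>(r, s). X $$ ((s div d) * d + r mod d, (r div d) * d + s mod d))"

definition swap_op :: "nat \<Rightarrow> complex mat" where
  "swap_op d = mat_sum (d * d) (d * d) (\<lambda>(k, l). kron (ketbra d k l) (ketbra d l k))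
     ({..<d} \<times> {..<d})"


section \<open>Pauli operators and data tables\<close>

definition pauli1 :: "nat \<Rightarrow> complex mat" where
  "pauli1 a = mat_of_rows_list 2
     (if a = 0 then [[1, 0], [0, 1]]
      else if a = 1 then [[0, 1], [1, 0]]
      else if a = 2 then [[0, - \<i>], [\<i>, 0]]
      else [[1, 0], [0, - 1]])"

text \<open>
  The index \<open>i < 4 ^ n\<close> is read as a string of \<open>n\<close> base-4 digits, most significant first; each
  digit selects one of the four single-qubit operators.
\<close>

fun pauli :: "nat \<Rightarrow> nat \<Rightarrow> complex mat" where
  "pauli 0 i = 1\<^sub>m 1"
| "pauli (Suc n) i = kron (pauli1 (i div 4 ^ n)) (pauli n (i mod 4 ^ n))"

text \<open>
  The operators built from a table of correlators, with the first index (\<open>pdm\<close>), respectively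
  the second index (\<open>pdm_rev\<close>), taken to be the earlier time.
\<close>

definition pdm :: "nat \<Rightarrow> (nat \<Rightarrow> nat \<Rightarrow> real) \<Rightarrow> complex mat" where
  "pdm n c = (1 / 4 ^ n) \<cdot>\<^sub>m mat_sum (2 ^ n * 2 ^ n) (2 ^ n * 2 ^ n)
     (\<lambda>(i, j). complex_of_real (c i j) \<cdot>\<^sub>m kron (pauli n i) (pauli n j))
     ({..<4 ^ n} \<times> {..<4 ^ n})"

definition pdm_rev :: "nat \<Rightarrow> (nat \<Rightarrow> nat \<Rightarrow> real) \<Rightarrow> complex mat" where
  "pdm_rev n c = (1 / 4 ^ n) \<cdot>\<^sub>m mat_sum (2 ^ n * 2 ^ n) (2 ^ n * 2 ^ n)
     (\<lambda>(i, j). complex_of_real (c i j) \<cdot>\<^sub>m kron (pauli n j) (pauli n i))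
     ({..<4 ^ n} \<times> {..<4 ^ n})"


section \<open>Quantum channels\<close>

text \<open>
  Maps on \<open>d\<close> by \<open>d\<close> matrices are functions on \<open>complex mat\<close> of which only the restriction to
  \<open>carrier_mat d d\<close> matters.
\<close>

definition linear_map_on_ops :: "nat \<Rightarrow> (complex mat \<Rightarrow> complex mat) \<Rightarrow> bool" where
  "linear_map_on_ops d E \<longleftrightarrow>
     (\<forall>X \<in> carrier_mat d d. E X \<in> carrier_mat d d) \<and>
     (\<forall>X \<in> carrier_mat d d. \<forall>Y \<in> carrier_mat d d. E (X + Y) = E X + E Y) \<and>
     (\<forall>a. \<forall>X \<in> carrier_mat d d. E (a \<cdot>\<^sub>m X) = a \<cdot>\<^sub>m E X)"

text \<open>
  \<open>ampliation m d E\<close> is $\mathrm{id}_m\otimes E$: it applies \<open>E\<close> to each \<open>d\<close> by \<open>d\<close> block.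
\<close>

definition ampliation ::
    "nat \<Rightarrow> nat \<Rightarrow> (complex mat \<Rightarrow> complex mat) \<Rightarrow> complex mat \<Rightarrow> complex mat" where
  "ampliation m d E X = mat (m * d) (m * d)
     (\<lambda>(r, s). E (mat d d (\<lambda>(i, j). X $$ ((r div d) * d + i, (s div d) * d + j)))
        $$ (r mod d, s mod d))"

definition completely_positive :: "nat \<Rightarrow> (complex mat \<Rightarrow> complex mat) \<Rightarrow> bool" where
  "completely_positive d E \<longleftrightarrow>
     (\<forall>m. \<forall>X \<in> carrier_mat (m * d) (m * d). psd X \<longrightarrow> psd (ampliation m d E X))"

definition trace_preserving :: "nat \<Rightarrow> (complex mat \<Rightarrow> complex mat) \<Rightarrow> bool" where
  "trace_preserving d E \<longleftrightarrow> (\<forall>X \<in> carrier_mat d d. mat_trace (E X) = mat_trace X)"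

definition cptp :: "nat \<Rightarrow> (complex mat \<Rightarrow> complex mat) \<Rightarrow> bool" where
  "cptp d E \<longleftrightarrow> linear_map_on_ops d E \<and> completely_positive d E \<and> trace_preserving d E"

text \<open>
  The Choi-Jamiolkowski matrix in the convention without partial transpose:
  $\sum_{k,l}|k\rangle\langle l|\otimes E(|l\rangle\langle k|)$.
\<close>

definition cj_matrix :: "nat \<Rightarrow> (complex mat \<Rightarrow> complex mat) \<Rightarrow> complex mat" where
  "cj_matrix d E = mat_sum (d * d) (d * d) (\<lambda>(k, l). kron (ketbra d k l) (E (ketbra d l k)))
     ({..<d} \<times> {..<d})"


section \<open>Consistency with the forward time flow\<close>

text \<open>\<open>sym_prod d w M\<close> is $\frac12((w\otimes 1)M + M(w\otimes 1))$.\<close>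

definition sym_prod :: "nat \<Rightarrow> complex mat \<Rightarrow> complex mat \<Rightarrow> complex mat" where
  "sym_prod d w M = (1 / 2) \<cdot>\<^sub>m (kron w (1\<^sub>m d) * M + M * kron w (1\<^sub>m d))"

definition consistent_forward :: "nat \<Rightarrow> complex mat \<Rightarrow> bool" where
  "consistent_forward d Q \<longleftrightarrow>
     density_matrix d (partial_trace2 d Q) \<and>
     (\<exists>E. cptp d E \<and> Q = sym_prod d (partial_trace2 d Q) (cj_matrix d E))"


section \<open>The two time orders are exchanged by the swap operator\<close>

lemma idx_less: "(i::nat) < d \<Longrightarrow> j < d \<Longrightarrow> i * d + j < d * d"
proof -
  assume "i < d" "j < d"
  then have "i * d + j < Suc i * d" by simp
  also have "\<dots> \<le> d * d" using \<open>i < d\<close> by (intro mult_le_mono1) simp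
  finally show ?thesis .
qed

lemma pauli_dim: "pauli n i \<in> carrier_mat (2 ^ n) (2 ^ n)"
proof (induction n arbitrary: i)
  case (Suc n)
  have "dim_row (pauli1 a) = 2" "dim_col (pauli1 a) = 2" for a
    by (simp_all add: pauli1_def mat_of_rows_list_def)
  moreover have "dim_row (pauli n j) = 2 ^ n" "dim_col (pauli n j) = 2 ^ n" for j
    using Suc.IH[of j] by auto
  ultimately show ?case
    by (intro carrier_matI) (simp_all only: pauli.simps kron_def dim_row_mat dim_col_mat power_Suc)
qed simp

lemma pdm_rev_index:
  assumes "r < 2 ^ n * 2 ^ n" "s < 2 ^ n * 2 ^ n"
  shows "pdm_rev n c $$ (r, s) =
    pdm n c $$ ((r mod 2 ^ n) * 2 ^ n + r div 2 ^ n, (s mod 2 ^ n) * 2 ^ n + s div 2 ^ n)"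
proof -
  let ?d = "2 ^ n :: nat"
  have dims: "dim_row (pauli n i) = ?d" "dim_col (pauli n i) = ?d" for i
    using pauli_dim[of n i] by auto
  have q: "r div ?d < ?d" "s div ?d < ?d" using assms by (simp_all add: less_mult_imp_div_less)
  then have "(r mod ?d) * ?d + r div ?d < ?d * ?d" "(s mod ?d) * ?d + s div ?d < ?d * ?d"
    by (auto intro!: idx_less)
  moreover have "(complex_of_real a \<cdot>\<^sub>m kron (pauli n j) (pauli n i)) $$ (r, s) =
      (complex_of_real a \<cdot>\<^sub>m kron (pauli n i) (pauli n j)) $$
        ((r mod ?d) * ?d + r div ?d, (s mod ?d) * ?d + s div ?d)" for a i j
    using calculation assms q by (simp add: kron_def dims)
  ultimately show ?thesis using assms
    by (simp add: pdm_def pdm_rev_def mat_sum_def split_beta)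
qed

lemma swap_op_index:
  assumes "r < d * d" "s < d * d"
  shows "swap_op d $$ (r, s) = (if s = (r mod d) * d + r div d then 1 else 0)"
proof -
  have d: "d > 0" using assms by (cases d) auto
  have q: "r div d < d" "s div d < d" using assms by (simp_all add: less_mult_imp_div_less)
  have eq: "s = (r mod d) * d + r div d \<longleftrightarrow> s div d = r mod d \<and> s mod d = r div d"
  proof
    assume "s div d = r mod d \<and> s mod d = r div d"
    then show "s = (r mod d) * d + r div d" using div_mult_mod_eq[of s d] by metis
  qed (use q d in simp)
  have "(case p of (k, l) \<Rightarrow> kron (ketbra d k l) (ketbra d l k)) $$ (r, s) =
      (if p = (r div d, s div d)
       then (if s div d = r mod d \<and> s mod d = r div d then 1 else 0) else 0)" for p
    using assms q d by (cases p) (auto simp: kron_def ketbra_def)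
  then have "swap_op d $$ (r, s) = (\<Sum>p\<in>{..<d} \<times> {..<d}. if p = (r div d, s div d)
       then (if s div d = r mod d \<and> s mod d = r div d then 1 else 0) else 0)"
    unfolding swap_op_def mat_sum_def using assms by simp
  also have "\<dots> = (if s div d = r mod d \<and> s mod d = r div d then 1 else 0)"
    using q by simp
  finally show ?thesis by (simp add: eq)
qed

lemma mult_index:
  assumes "A \<in> carrier_mat k k" "B \<in> carrier_mat k k" "i < k" "j < k"
  shows "(A * B) $$ (i, j) = (\<Sum>u<k. A $$ (i, u) * (B $$ (u, j) :: complex))"
  using assms by (simp add: scalar_prod_def lessThan_atLeast0)

lemma pdm_rev_eq_swap:
  "pdm_rev n c = swap_op (2 ^ n) * pdm n c * mat_adjoint (swap_op (2 ^ n))"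
proof -
  let ?d = "2 ^ n :: nat" and ?S = "swap_op (2 ^ n)"
  let ?sw = "\<lambda>r. (r mod ?d) * ?d + r div ?d"
  have swlt: "?sw r < ?d * ?d" if "r < ?d * ?d" for r
    using that by (intro idx_less) (simp_all add: less_mult_imp_div_less)
  have dS: "?S \<in> carrier_mat (?d * ?d) (?d * ?d)" by (simp add: swap_op_def mat_sum_def)
  have dR: "pdm n c \<in> carrier_mat (?d * ?d) (?d * ?d)" by (simp add: pdm_def mat_sum_def)
  have dA: "mat_adjoint ?S \<in> carrier_mat (?d * ?d) (?d * ?d)"
    using dS by (simp add: mat_adjoint_def mat_of_rows_def)
  have A: "mat_adjoint ?S $$ (t, s) = (if t = ?sw s then 1 else 0)"
    if "t < ?d * ?d" "s < ?d * ?d" for t s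
    using that dS by (simp add: mat_adjoint_def mat_of_rows_def swap_op_index)
  have 1: "(?S * pdm n c) $$ (r, t) = pdm n c $$ (?sw r, t)"
    if "r < ?d * ?d" "t < ?d * ?d" for r t
  proof -
    have "(?S * pdm n c) $$ (r, t) = (\<Sum>u<?d * ?d. ?S $$ (r, u) * pdm n c $$ (u, t))"
      by (rule mult_index[OF dS dR that])
    also have "\<dots> = (\<Sum>u<?d * ?d. if u = ?sw r then pdm n c $$ (u, t) else 0)"
      using that by (intro sum.cong) (auto simp: swap_op_index)
    finally show ?thesis using swlt[OF that(1)] by simp
  qed
  have 2: "(?S * pdm n c * mat_adjoint ?S) $$ (r, s) = pdm n c $$ (?sw r, ?sw s)"
    if "r < ?d * ?d" "s < ?d * ?d" for r s
  proof -
    have "(?S * pdm n c * mat_adjoint ?S) $$ (r, s)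
      = (\<Sum>t<?d * ?d. (?S * pdm n c) $$ (r, t) * mat_adjoint ?S $$ (t, s))"
      by (rule mult_index[OF mult_carrier_mat[OF dS dR] dA that])
    also have "\<dots> = (\<Sum>t<?d * ?d. if t = ?sw s then pdm n c $$ (?sw r, t) else 0)"
      using that by (intro sum.cong) (auto simp: 1 A)
    finally show ?thesis using swlt[OF that(2)] by simp
  qed
  show ?thesis
  proof (rule eq_matI)
    fix r s
    assume "r < dim_row (?S * pdm n c * mat_adjoint ?S)" "s < dim_col (?S * pdm n c * mat_adjoint ?S)"
    then have "r < ?d * ?d" "s < ?d * ?d" using dS dA by auto
    then show "pdm_rev n c $$ (r, s) = (?S * pdm n c * mat_adjoint ?S) $$ (r, s)"
      by (simp only: 2 pdm_rev_index)
  qed (use dS dA in \<open>auto simp: pdm_rev_def mat_sum_def\<close>)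
qed

lemma partial_trace1_pdm: "partial_trace1 (2 ^ n) (pdm n c) = partial_trace2 (2 ^ n) (pdm_rev n c)"
proof -
  let ?d = "2 ^ n :: nat"
  have "pdm_rev n c $$ (i * ?d + k, j * ?d + k) = pdm n c $$ (k * ?d + i, k * ?d + j)"
    if "i < ?d" "j < ?d" "k < ?d" for i j k
  proof -
    have "(i * ?d + k) mod ?d = k" "(i * ?d + k) div ?d = i"
      "(j * ?d + k) mod ?d = k" "(j * ?d + k) div ?d = j" using that by simp_all
    then show ?thesis
      using pdm_rev_index[OF idx_less[OF that(1,3)] idx_less[OF that(2,3)], of c] by (simp only:)
  qed
  then show ?thesis
    unfolding partial_trace1_def partial_trace2_def by (intro eq_matI) simp_all
qed

end

theory Submission
  imports Defs
begin

text \<open>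
  For a positive definite \<open>A\<close>, the equation \<open>A X + X A = 0\<close> forces \<open>X = 0\<close>: multiplying by the adjoint
  of \<open>X\<close> and taking the trace gives a sum of values of the form of \<open>A\<close> at the columns and the
  conjugated rows of \<open>X\<close>, all nonnegative, so each of them vanishes. Hence the matrix extracted from
  an operator with full-rank marginal is unique. If \<open>Rbar\<close> came from a channel \<open>E\<close>, then \<open>Mbar\<close> would
  be the Choi-Jamiolkowski matrix of \<open>E\<close>, whose partial transpose is the image of the maximally
  entangled operator under \<open>id \<otimes> E\<close> and thus positive semidefinite. So \<open>Rbar\<close> is not consistent,
  and one of the two operators is.
\<close>

section \<open>Coordinate formulas for flattened indices, inner products and adjoints\<close>

lemma sum_lessThan_mult_split:
  fixes f :: "nat \<Rightarrow> 'a::comm_monoid_add"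
  shows "(\<Sum>r<m * k. f r) = (\<Sum>i<m. \<Sum>j<k. f (i * k + j))"
proof -
  have "(\<Sum>r<m * k. f r) = (\<Sum>i<m. sum f {i * k..<i * k + k})"
    by (rule sum.nat_group[symmetric])
  moreover have "sum f {i * k..<i * k + k} = (\<Sum>j<k. f (i * k + j))" for i
    using sum.shift_bounds_nat_ivl[of f 0 "i * k" k]
    by (simp add: lessThan_atLeast0 add.commute)
  ultimately show ?thesis by simp
qed

lemma idx_div_mod_less:
  fixes r d :: nat
  assumes "r < d * d"
  shows "r div d < d" "r mod d < d"
  using assms by (auto simp: less_mult_imp_div_less intro!: mod_less_divisor gr0I)

lemma mult_mat_vec_index_sum:
  assumes "A \<in> carrier_mat m k" "v \<in> carrier_vec k" "i < m"
  shows "(A *\<^sub>v v) $ i = (\<Sum>j<k. A $$ (i, j) * v $ j)"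
  using assms by (simp add: scalar_prod_def lessThan_atLeast0)

lemma cscalar_prod_sum:
  fixes u v :: "complex vec"
  assumes "v \<in> carrier_vec k"
  shows "u \<bullet>c v = (\<Sum>i<k. u $ i * cnj (v $ i))"
  using assms by (simp add: scalar_prod_def lessThan_atLeast0)

lemma mat_adjoint_index:
  fixes A :: "complex mat"
  assumes "A \<in> carrier_mat k k" "i < k" "j < k"
  shows "mat_adjoint A $$ (i, j) = cnj (A $$ (j, i))"
  using assms by (simp add: mat_adjoint_def mat_of_rows_def)

lemma hermitian_iff_index:
  fixes A :: "complex mat"
  assumes "A \<in> carrier_mat k k"
  shows "mat_adjoint A = A \<longleftrightarrow> (\<forall>i<k. \<forall>j<k. A $$ (i, j) = cnj (A $$ (j, i)))"
proof
  assume "mat_adjoint A = A"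
  then show "\<forall>i<k. \<forall>j<k. A $$ (i, j) = cnj (A $$ (j, i))"
    using mat_adjoint_index[OF assms] by metis
next
  assume *: "\<forall>i<k. \<forall>j<k. A $$ (i, j) = cnj (A $$ (j, i))"
  show "mat_adjoint A = A"
  proof (rule eq_matI)
    show "dim_row (mat_adjoint A) = dim_row A" "dim_col (mat_adjoint A) = dim_col A"
      using assms by (simp_all add: mat_adjoint_def)
    fix i j assume "i < dim_row A" "j < dim_col A"
    then have "i < k" "j < k" using assms by auto
    then show "mat_adjoint A $$ (i, j) = A $$ (i, j)" using * mat_adjoint_index[OF assms] by metis
  qed
qed

section \<open>Hermitian and positive semidefinite forms\<close>

lemma hermitian_cscalar_prod:
  fixes A :: "complex mat"
  assumes A: "A \<in> carrier_mat k k" "mat_adjoint A = A"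
    and "u \<in> carrier_vec k" "v \<in> carrier_vec k"
  shows "(A *\<^sub>v u) \<bullet>c v = u \<bullet>c (A *\<^sub>v v)"
proof -
  have h: "A $$ (i, j) = cnj (A $$ (j, i))" if "i < k" "j < k" for i j
    using that A hermitian_iff_index by blast
  have "(A *\<^sub>v u) \<bullet>c v = (\<Sum>i<k. \<Sum>j<k. A $$ (i, j) * u $ j * cnj (v $ i))"
    using assms by (simp add: cscalar_prod_sum mult_mat_vec_index_sum sum_distrib_right
        del: index_mult_mat_vec)
  also have "\<dots> = (\<Sum>i<k. \<Sum>j<k. cnj (A $$ (j, i)) * u $ j * cnj (v $ i))"
    by (intro sum.cong refl) (subst h, simp_all)
  also have "\<dots> = (\<Sum>j<k. \<Sum>i<k. cnj (A $$ (j, i)) * u $ j * cnj (v $ i))"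
    by (rule sum.swap)
  also have "\<dots> = u \<bullet>c (A *\<^sub>v v)"
  proof -
    have Av: "A *\<^sub>v v \<in> carrier_vec k" using assms by simp
    show ?thesis
      unfolding cscalar_prod_sum[OF Av] using assms
      by (intro sum.cong) (simp_all add: mult_mat_vec_index_sum sum_distrib_left ac_simps
        del: index_mult_mat_vec)
  qed
  finally show ?thesis .
qed

text \<open>Otherwise moving from \<open>v\<close> in the direction \<open>- A v\<close> would make the form negative.\<close>

lemma psd_form_zero_imp_kernel:
  assumes A: "A \<in> carrier_mat k k" "psd A" and v: "v \<in> carrier_vec k"
    and 0: "(A *\<^sub>v v) \<bullet>c v = 0"
  shows "A *\<^sub>v v = 0\<^sub>v k"
proof -
  define w where "w = A *\<^sub>v v"
  have w: "w \<in> carrier_vec k" and Aw: "A *\<^sub>v w \<in> carrier_vec k"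
    using A v by (auto simp: w_def)
  have adj: "mat_adjoint A = A" using A by (simp add: psd_def)
  have form: "0 \<le> (A *\<^sub>v x) \<bullet>c x" if "x \<in> carrier_vec k" for x
    using A that by (auto simp: psd_def)
  define a where "a = Re (w \<bullet>c w)"
  define c where "c = Re ((A *\<^sub>v w) \<bullet>c w)"
  have a0: "0 \<le> a" using conjugate_square_ge_0_vec[of w] by (simp add: a_def less_eq_complex_def)
  have c0: "0 \<le> c" using form[OF w] by (simp add: c_def less_eq_complex_def)
  have wv: "(A *\<^sub>v w) \<bullet>c v = w \<bullet>c w"
    using hermitian_cscalar_prod[OF A(1) adj w v] by (simp add: w_def)
  \<comment> \<open>This is the form at \<open>v - t w\<close>. Its constant term vanishes by
    assumption \<open>0\<close>, and by \<open>wv\<close> the two cross terms contribute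
    \<open>- t a\<close> each.\<close>
  have key: "0 \<le> t * t * c - 2 * t * a" for t :: real
  proof -
    define s where "s = complex_of_real (- t)"
    define u where "u = v + s \<cdot>\<^sub>v w"
    have u: "u \<in> carrier_vec k" using v w by (simp add: u_def)
    have Au: "A *\<^sub>v u = w + s \<cdot>\<^sub>v (A *\<^sub>v w)"
      using A v w by (simp add: u_def mult_add_distrib_mat_vec mult_mat_vec w_def)
    have cu: "conjugate u = conjugate v + s \<cdot>\<^sub>v conjugate w"
      using v w by (simp add: u_def s_def conjugate_add_vec[of _ k] conjugate_smult_vec)
    have "(A *\<^sub>v u) \<bullet>c u = w \<bullet>c v + s * (w \<bullet>c w) + (s * ((A *\<^sub>v w) \<bullet>c v) + s * (s * ((A *\<^sub>v w) \<bullet>c w)))"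
      using v w Aw unfolding Au cu
      by (simp add: add_scalar_prod_distrib[of _ k] scalar_prod_add_distrib[of _ k])
    also have "\<dots> = complex_of_real (- 2 * t) * (w \<bullet>c w) + complex_of_real (t * t) * ((A *\<^sub>v w) \<bullet>c w)"
      using 0 by (simp add: wv s_def flip: w_def)
    finally have "Re ((A *\<^sub>v u) \<bullet>c u) = t * t * c - 2 * t * a"
      by (simp add: a_def c_def)
    then show ?thesis using form[OF u] by (simp add: less_eq_complex_def)
  qed
  have "a = 0"
  proof (rule ccontr)
    assume "a \<noteq> 0"
    with a0 have "0 < a" by simp
    \<comment> \<open>The quadratic is smallest at \<open>a / c\<close>. Dividing by
      \<open>c + 1\<close> instead also covers \<open>c = 0\<close> and still gives
      \<open>t c - 2 a = - a - t < 0\<close>.\<close>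
    define t where "t = a / (c + 1)"
    have "0 < t" using \<open>0 < a\<close> c0 by (simp add: t_def)
    have "t * (c + 1) = a" using c0 by (simp add: t_def)
    then have "t * c - 2 * a < 0" using \<open>0 < t\<close> \<open>0 < a\<close> by (simp add: distrib_left)
    then have "t * (t * c - 2 * a) < 0" using \<open>0 < t\<close> by (simp add: mult_pos_neg)
    then show False using key[of t] by (simp add: algebra_simps)
  qed
  \<comment> \<open>The order on complex numbers makes \<open>w \<bullet>c w\<close> real, so its
    real part \<open>a\<close> determines it.\<close>
  then have "w \<bullet>c w = 0"
    using conjugate_square_ge_0_vec[of w] by (simp add: complex_eq_iff a_def less_eq_complex_def)
  then show ?thesis using conjugate_square_eq_0_vec[OF w] by (simp add: w_def)
qed

text \<open>A zero of the form lies in the kernel of \<open>A\<close>, which is trivial because the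
  determinant is nonzero. This gives definiteness.\<close>

lemma psd_full_rank_form_zero:
  assumes "A \<in> carrier_mat k k" "psd A" "det A \<noteq> 0" "v \<in> carrier_vec k" "(A *\<^sub>v v) \<bullet>c v = 0"
  shows "v = 0\<^sub>v k"
  using psd_form_zero_imp_kernel[OF assms(1,2,4,5)] det_0_iff_vec_prod_zero_field[OF assms(1)] assms
  by blast

section \<open>The Lyapunov equation\<close>

lemma lyapunov_homogeneous:
  assumes A: "A \<in> carrier_mat k k" "psd A" "det A \<noteq> 0" and X: "X \<in> carrier_mat k k"
    and eq: "A * X + X * A = 0\<^sub>m k k"
  shows "X = 0\<^sub>m k k"
proof -
  define p where "p j = (A *\<^sub>v col X j) \<bullet>c col X j" for j
  \<comment> \<open>With \<open>X'\<close> the adjoint of \<open>X\<close>, \<open>p j\<close> is a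
    diagonal entry of \<open>X' A X\<close>. Conjugating the rows makes \<open>q i\<close> a
    diagonal entry of \<open>X A X'\<close>.\<close>
  define q where "q i = (A *\<^sub>v conjugate (row X i)) \<bullet>c conjugate (row X i)" for i
  have cX: "col X j \<in> carrier_vec k" for j using X by auto
  have rX: "conjugate (row X i) \<in> carrier_vec k" for i using X by auto
  have form: "0 \<le> (A *\<^sub>v x) \<bullet>c x" if "x \<in> carrier_vec k" for x
    using A that by (auto simp: psd_def)
  have p0: "0 \<le> p j" and q0: "0 \<le> q j" for j
    using form[OF cX] form[OF rX] by (auto simp: p_def q_def)
  have p: "p j = (\<Sum>i<k. (A * X) $$ (i, j) * cnj (X $$ (i, j)))" if "j < k" for j
    using A X cX that unfolding p_def
    by (simp add: cscalar_prod_sum[OF cX])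
  have q: "q i = (\<Sum>j<k. (X * A) $$ (i, j) * cnj (X $$ (i, j)))" if "i < k" for i
  proof -
    have "q i = (\<Sum>l<k. \<Sum>j<k. A $$ (l, j) * cnj (X $$ (i, j)) * X $$ (i, l))"
      unfolding q_def cscalar_prod_sum[OF rX] using A X rX that
      by (intro sum.cong)
        (simp_all add: mult_mat_vec_index_sum[OF A(1) rX] sum_distrib_right del: index_mult_mat_vec)
    also have "\<dots> = (\<Sum>j<k. \<Sum>l<k. A $$ (l, j) * cnj (X $$ (i, j)) * X $$ (i, l))"
      by (rule sum.swap)
    also have "\<dots> = (\<Sum>j<k. (X * A) $$ (i, j) * cnj (X $$ (i, j)))"
      using A X that
      by (intro sum.cong)
        (simp_all add: mult_index[OF X A(1)] sum_distrib_left sum_distrib_right ac_simps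
          del: index_mult_mat)
    finally show ?thesis .
  qed
  \<comment> \<open>The two traces add up to the Hilbert-Schmidt product of \<open>A X + X A\<close>
    with \<open>X\<close>.\<close>
  have "(\<Sum>j<k. p j) + (\<Sum>i<k. q i)
      = (\<Sum>i<k. \<Sum>j<k. ((A * X) $$ (i, j) + (X * A) $$ (i, j)) * cnj (X $$ (i, j)))"
    using sum.swap[of "\<lambda>j i. (A * X) $$ (i, j) * cnj (X $$ (i, j))" "{..<k}" "{..<k}"]
    by (simp add: p q sum.distrib distrib_right)
  also have "\<dots> = (\<Sum>i<k. \<Sum>j<k. (A * X + X * A) $$ (i, j) * cnj (X $$ (i, j)))"
    using A X by (intro sum.cong) auto
  also have "\<dots> = 0" unfolding eq by simp
  finally have "(\<Sum>j<k. p j) + (\<Sum>i<k. q i) = 0" .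
  moreover have "0 \<le> (\<Sum>j<k. p j)" "0 \<le> (\<Sum>i<k. q i)"
    using p0 q0 by (simp_all add: sum_nonneg)
  ultimately have "(\<Sum>j<k. p j) = 0"
    using add_nonneg_eq_0_iff by blast
  then have "p j = 0" if "j < k" for j
    using that p0 sum_nonneg_eq_0_iff[of "{..<k}" p] by auto
  then have "col X j = 0\<^sub>v k" if "j < k" for j
    using that psd_full_rank_form_zero[OF A cX] by (simp add: p_def)
  then have "X $$ (i, j) = 0" if "i < k" "j < k" for i j
    using that X by (metis carrier_matD index_col index_zero_vec(1))
  then show ?thesis using X by (intro eq_matI) auto
qed

lemma mult_mat_vec_surj:
  fixes K :: "'a::field mat"
  assumes K: "K \<in> carrier_mat m m" "det K \<noteq> 0" and y: "y \<in> carrier_vec m"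
  obtains v where "v \<in> carrier_vec m" "K *\<^sub>v v = y"
proof -
  from det_non_zero_imp_unit[OF K]
  obtain B where B: "B \<in> carrier_mat m m" "K * B = 1\<^sub>m m"
    by (auto simp: Units_def ring_mat_def)
  have "K *\<^sub>v (B *\<^sub>v y) = y"
    using K B y by (simp flip: assoc_mult_mat_vec)
  then show thesis using that[of "B *\<^sub>v y"] B y by auto
qed

text \<open>
  Existence follows from uniqueness by finite dimension; \<open>K\<close> is the matrix of
  \<open>X \<mapsto> A X + X A\<close> with respect to the row-major flattening of \<open>X\<close>.
\<close>

lemma lyapunov_ex1:
  assumes A: "A \<in> carrier_mat k k" "psd A" "det A \<noteq> 0" and Y: "Y \<in> carrier_mat k k"
  shows "\<exists>!X. X \<in> carrier_mat k k \<and> A * X + X * A = Y"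
proof -
  \<comment> \<open>In this flattening, left multiplication by \<open>A\<close> is
    \<open>A \<otimes> 1\<close> and right multiplication is \<open>1 \<otimes> B\<close> with
    \<open>B\<close> the transpose of \<open>A\<close>; \<open>K\<close> is their sum.
    \<open>U\<close> undoes the flattening.\<close>
  define K where "K = mat (k * k) (k * k) (\<lambda>(r, s).
    (if s mod k = r mod k then A $$ (r div k, s div k) else 0) +
    (if s div k = r div k then A $$ (s mod k, r mod k) else 0))"
  define U :: "complex vec \<Rightarrow> complex mat" where "U v = mat k k (\<lambda>(i, j). v $ (i * k + j))" for v
  have K: "K \<in> carrier_mat (k * k) (k * k)" by (simp add: K_def)
  have U: "U v \<in> carrier_mat k k" for v by (simp add: U_def)
  have KU: "(K *\<^sub>v v) $ (i * k + j) = (A * U v + U v * A) $$ (i, j)"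
    if v: "v \<in> carrier_vec (k * k)" and ij: "i < k" "j < k" for v i j
  proof -
    have "(K *\<^sub>v v) $ (i * k + j) = (\<Sum>a<k. \<Sum>b<k. K $$ (i * k + j, a * k + b) * v $ (a * k + b))"
      using mult_mat_vec_index_sum[OF K v idx_less[OF ij]] by (simp only: sum_lessThan_mult_split)
    also have "\<dots> = (\<Sum>a<k. \<Sum>b<k. (if b = j then A $$ (i, a) * v $ (a * k + b) else 0)
        + (if a = i then A $$ (b, j) * v $ (a * k + b) else 0))"
      using ij by (intro sum.cong refl) (auto simp: K_def idx_less distrib_right)
    also have "\<dots> = (\<Sum>a<k. A $$ (i, a) * v $ (a * k + j)) + (\<Sum>b<k. A $$ (b, j) * v $ (i * k + b))"
    proof -
      \<comment> \<open>The condition on \<open>a\<close> is moved out of the inner sum so that the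
        outer sum collapses to \<open>a = i\<close>.\<close>
      have "(\<Sum>a<k. \<Sum>b<k. if a = i then A $$ (b, j) * v $ (a * k + b) else 0)
          = (\<Sum>a<k. if a = i then \<Sum>b<k. A $$ (b, j) * v $ (a * k + b) else 0)"
        by (intro sum.cong) auto
      then show ?thesis using ij by (simp add: sum.distrib)
    qed
    also have "\<dots> = (A * U v) $$ (i, j) + (U v * A) $$ (i, j)"
      unfolding mult_index[OF A(1) U ij] mult_index[OF U A(1) ij]
      using ij by (simp add: U_def mult.commute)
    also have "\<dots> = (A * U v + U v * A) $$ (i, j)"
      using A U[of v] ij by (simp del: index_mult_mat(1))
    finally show ?thesis .
  qed
  \<comment> \<open>Unflattening a kernel vector of \<open>K\<close> gives a solution of the
    homogeneous equation, hence zero.\<close>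
  have "det K \<noteq> 0"
  proof
    assume "det K = 0"
    then obtain v where v: "v \<in> carrier_vec (k * k)" "v \<noteq> 0\<^sub>v (k * k)" "K *\<^sub>v v = 0\<^sub>v (k * k)"
      using det_0_iff_vec_prod_zero_field[OF K] by blast
    have "A * U v + U v * A = 0\<^sub>m k k"
      using KU[OF v(1)] A U[of v]
      by (intro eq_matI) (simp_all add: v(3) idx_less del: index_mult_mat(1) index_add_mat(1))
    then have "U v = 0\<^sub>m k k" using lyapunov_homogeneous[OF A U] by blast
    moreover have "v $ r = U v $$ (r div k, r mod k)" if "r < k * k" for r
    proof -
      from that have "r div k < k" "r mod k < k"
        by (simp_all only: idx_div_mod_less)
      then show ?thesis by (simp add: U_def)
    qed
    ultimately have "v = 0\<^sub>v (k * k)"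
      using v(1) idx_div_mod_less by (intro eq_vecI) simp_all
    with v(2) show False by simp
  qed
  then obtain v where v: "v \<in> carrier_vec (k * k)"
    "K *\<^sub>v v = vec (k * k) (\<lambda>r. Y $$ (r div k, r mod k))"
    by (rule mult_mat_vec_surj[OF K _ vec_carrier])
  have "A * U v + U v * A = Y"
    using KU[OF v(1)] A U[of v] Y
    by (intro eq_matI) (simp_all add: v(2) idx_less del: index_mult_mat(1) index_add_mat(1))
  moreover have "X = X'" if X: "X \<in> carrier_mat k k" "A * X + X * A = Y"
    and X': "X' \<in> carrier_mat k k" "A * X' + X' * A = Y" for X X'
  proof -
    have "A * (X - X') + (X - X') * A = (A * X - A * X') + (X * A - X' * A)"
      using A X X' by (simp add: mult_minus_distrib_mat minus_mult_distrib_mat)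
    also have "\<dots> = (A * X + X * A) - (A * X' + X' * A)"
      using A X(1) X'(1) by (intro eq_matI) auto
    also have "\<dots> = 0\<^sub>m k k" using X X' Y by simp
    finally have "X - X' = 0\<^sub>m k k"
      by (rule lyapunov_homogeneous[OF A minus_carrier_mat[OF X'(1)]])
    then have "(X - X') $$ (i, j) = 0" if "i < k" "j < k" for i j using that by simp
    then show ?thesis using X(1) X'(1) by (intro eq_matI) auto
  qed
  ultimately show ?thesis using U by blast
qed

section \<open>The operator \<open>w \<otimes> 1\<close> and uniqueness of the extracted
  matrix\<close>

lemma kron_one_carrier: "w \<in> carrier_mat d d \<Longrightarrow> kron w (1\<^sub>m d) \<in> carrier_mat (d * d) (d * d)"
  by (simp add: kron_def)

text \<open>The identity factor fixes the second index \<open>a\<close>, so \<open>w\<close> acts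
  separately on each slice of \<open>v\<close> with constant \<open>a\<close>. Positivity and
  invertibility of \<open>w \<otimes> 1\<close> reduce to those of \<open>w\<close> in this
  way.\<close>

lemma kron_one_mult_vec_block:
  assumes w: "w \<in> carrier_mat d d" and v: "v \<in> carrier_vec (d * d)" and ia: "i < d" "a < d"
  shows "(kron w (1\<^sub>m d) *\<^sub>v v) $ (i * d + a) = (w *\<^sub>v vec d (\<lambda>j. v $ (j * d + a))) $ i"
proof -
  have "(kron w (1\<^sub>m d) *\<^sub>v v) $ (i * d + a)
      = (\<Sum>j<d. \<Sum>b<d. kron w (1\<^sub>m d) $$ (i * d + a, j * d + b) * v $ (j * d + b))"
    using mult_mat_vec_index_sum[OF kron_one_carrier[OF w] v idx_less[OF ia]]
    by (simp only: sum_lessThan_mult_split)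
  also have "\<dots> = (\<Sum>j<d. \<Sum>b<d. if b = a then w $$ (i, j) * v $ (j * d + b) else 0)"
    using w ia by (intro sum.cong refl) (auto simp: kron_def idx_less)
  also have "\<dots> = (\<Sum>j<d. w $$ (i, j) * v $ (j * d + a))"
    using ia by simp
  also have "\<dots> = (w *\<^sub>v vec d (\<lambda>j. v $ (j * d + a))) $ i"
    by (subst mult_mat_vec_index_sum[OF w _ ia(1)]) auto
  finally show ?thesis .
qed

text \<open>The form at \<open>v\<close> is the sum of the forms of \<open>w\<close> at the slices
  of \<open>v\<close>.\<close>

lemma psd_kron_one:
  assumes w: "w \<in> carrier_mat d d" "psd w"
  shows "psd (kron w (1\<^sub>m d))"
proof -
  let ?A = "kron w (1\<^sub>m d)"
  have A: "?A \<in> carrier_mat (d * d) (d * d)" using w(1) by (rule kron_one_carrier)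
  have h: "w $$ (i, j) = cnj (w $$ (j, i))" if "i < d" "j < d" for i j
    using w that hermitian_iff_index[OF w(1)] unfolding psd_def by blast
  have "?A $$ (r, s) = cnj (?A $$ (s, r))" if "r < d * d" "s < d * d" for r s
  proof -
    have lt: "r div d < d" "s div d < d" "r mod d < d" "s mod d < d"
      using that by (simp_all only: idx_div_mod_less)
    show ?thesis using h[OF lt(1,2)] that lt w(1) by (simp add: kron_def)
  qed
  then have "mat_adjoint ?A = ?A" using hermitian_iff_index[OF A] by blast
  moreover have "0 \<le> (?A *\<^sub>v v) \<bullet>c v" if v: "v \<in> carrier_vec (d * d)" for v
  proof -
    define b where "b a = vec d (\<lambda>j. v $ (j * d + a))" for a
    have b: "b a \<in> carrier_vec d" for a by (simp add: b_def)
    have "(?A *\<^sub>v v) \<bullet>c v = (\<Sum>i<d. \<Sum>a<d. (?A *\<^sub>v v) $ (i * d + a) * cnj (v $ (i * d + a)))"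
      by (simp only: cscalar_prod_sum[OF v] sum_lessThan_mult_split)
    also have "\<dots> = (\<Sum>i<d. \<Sum>a<d. (w *\<^sub>v b a) $ i * cnj (b a $ i))"
      by (intro sum.cong refl) (simp add: kron_one_mult_vec_block[OF w(1) v] b_def
          del: index_mult_mat_vec)
    also have "\<dots> = (\<Sum>a<d. (w *\<^sub>v b a) \<bullet>c b a)"
      by (subst sum.swap) (simp add: cscalar_prod_sum[OF b])
    also have "0 \<le> \<dots>" using w b by (intro sum_nonneg) (auto simp: psd_def)
    finally show ?thesis .
  qed
  ultimately show ?thesis using A unfolding psd_def by simp
qed

text \<open>Every slice of a kernel vector lies in the kernel of \<open>w\<close>, so all its
  entries vanish.\<close>

lemma det_kron_one_nonzero:
  assumes w: "w \<in> carrier_mat d d" "det w \<noteq> 0"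
  shows "det (kron w (1\<^sub>m d)) \<noteq> 0"
proof
  let ?A = "kron w (1\<^sub>m d)"
  assume "det ?A = 0"
  then obtain v where v: "v \<in> carrier_vec (d * d)" "v \<noteq> 0\<^sub>v (d * d)" "?A *\<^sub>v v = 0\<^sub>v (d * d)"
    using det_0_iff_vec_prod_zero_field[OF kron_one_carrier[OF w(1)]] by blast
  have "v $ r = 0" if r: "r < d * d" for r
  proof -
    have lt: "r div d < d" "r mod d < d"
      using r by (simp_all only: idx_div_mod_less)
    define b where "b = vec d (\<lambda>j. v $ (j * d + r mod d))"
    have "w *\<^sub>v b = 0\<^sub>v d"
    proof (rule eq_vecI)
      fix i assume "i < dim_vec (0\<^sub>v d)"
      then have i: "i < d" by simp
      show "(w *\<^sub>v b) $ i = 0\<^sub>v d $ i"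
        using kron_one_mult_vec_block[OF w(1) v(1) i lt(2)] i lt(2)
        by (simp add: v(3) idx_less b_def del: index_mult_mat_vec)
    qed (use w in auto)
    moreover have "b \<in> carrier_vec d" by (simp add: b_def)
    ultimately have "b = 0\<^sub>v d" using det_0_iff_vec_prod_zero_field[OF w(1)] w(2) by blast
    then have "b $ (r div d) = 0" using lt by simp
    then show ?thesis using lt by (simp add: b_def)
  qed
  then have "v = 0\<^sub>v (d * d)" using v(1) by (intro eq_vecI) auto
  with v(2) show False by simp
qed

text \<open>Clearing the factor 1/2 turns this into the Lyapunov equation for
  \<open>w \<otimes> 1\<close> with right-hand side \<open>2 Q\<close>; full rank of
  \<open>w\<close> supplies the nonzero determinant.\<close>

lemma sym_prod_ex1:
  assumes w: "w \<in> carrier_mat d d" "psd w" "vec_space.rank d w = d"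
    and Q: "Q \<in> carrier_mat (d * d) (d * d)"
  shows "\<exists>!M. M \<in> carrier_mat (d * d) (d * d) \<and> Q = sym_prod d w M"
proof -
  let ?A = "kron w (1\<^sub>m d)"
  have A: "?A \<in> carrier_mat (d * d) (d * d)" using w(1) by (rule kron_one_carrier)
  have "det w \<noteq> 0" using vec_space.det_rank_iff[OF w(1)] w(3) by blast
  have iff: "Q = sym_prod d w M \<longleftrightarrow> ?A * M + M * ?A = 2 \<cdot>\<^sub>m Q"
    if "M \<in> carrier_mat (d * d) (d * d)" for M
  proof -
    let ?B = "?A * M + M * ?A"
    have B: "?B \<in> carrier_mat (d * d) (d * d)" using A that by simp
    have "Q = (1 / 2) \<cdot>\<^sub>m ?B \<Longrightarrow> ?B = 2 \<cdot>\<^sub>m Q"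
      using B by (intro eq_matI) (simp_all del: index_mult_mat(1) index_add_mat(1))
    moreover have "(1 / 2) \<cdot>\<^sub>m (2 \<cdot>\<^sub>m Q) = Q" by (intro eq_matI) auto
    ultimately show ?thesis unfolding sym_prod_def by metis
  qed
  have "\<exists>!M. M \<in> carrier_mat (d * d) (d * d) \<and> ?A * M + M * ?A = 2 \<cdot>\<^sub>m Q"
    by (rule lyapunov_ex1[OF A psd_kron_one[OF w(1,2)] det_kron_one_nonzero[OF w(1) \<open>det w \<noteq> 0\<close>]])
      (use Q in simp)
  then show ?thesis using iff by metis
qed

section \<open>Complete positivity and the Choi--Jamiolkowski matrix\<close>

text \<open>The unnormalized operator |Omega><Omega| for Omega the sum of all |kk>; the index of
  |kk> is the one whose quotient and remainder by \<open>d\<close> agree.\<close>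

definition max_entangled :: "nat \<Rightarrow> complex mat" where
  "max_entangled d = mat (d * d) (d * d)
     (\<lambda>(r, s). if r div d = r mod d \<and> s div d = s mod d then 1 else 0)"

text \<open>The operator has rank at most one, and its form at \<open>v\<close> is the squared
  modulus of <Omega|v>.\<close>

lemma psd_max_entangled: "psd (max_entangled d)"
proof -
  let ?W = "max_entangled d"
  have W: "?W \<in> carrier_mat (d * d) (d * d)" by (simp add: max_entangled_def)
  have "mat_adjoint ?W = ?W"
    unfolding hermitian_iff_index[OF W] by (auto simp: max_entangled_def)
  moreover have "0 \<le> (?W *\<^sub>v v) \<bullet>c v" if v: "v \<in> carrier_vec (d * d)" for v
  proof -
    \<comment> \<open>\<open>D\<close> is the support of Omega, so \<open>x\<close> is
      <Omega|v>.\<close>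
    define D where "D = {r. r < d * d \<and> r div d = r mod d}"
    define x where "x = (\<Sum>s\<in>D. v $ s)"
    have D: "D \<subseteq> {..<d * d}" by (auto simp: D_def)
    have Wv: "(?W *\<^sub>v v) $ r = (if r \<in> D then x else 0)" if "r < d * d" for r
    proof -
      have "(?W *\<^sub>v v) $ r = (\<Sum>s<d * d. if s \<in> D then (if r \<in> D then v $ s else 0) else 0)"
        unfolding mult_mat_vec_index_sum[OF W v that]
        using that by (intro sum.cong refl) (auto simp: max_entangled_def D_def)
      also have "\<dots> = (\<Sum>s\<in>D. if r \<in> D then v $ s else 0)"
        using D by (simp add: sum.If_cases Int_absorb1)
      finally show ?thesis by (simp add: x_def)
    qed
    have "(?W *\<^sub>v v) \<bullet>c v = (\<Sum>r<d * d. if r \<in> D then x * cnj (v $ r) else 0)"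
      unfolding cscalar_prod_sum[OF v] by (intro sum.cong refl) (simp add: Wv del: index_mult_mat_vec)
    also have "\<dots> = x * cnj x"
      using D by (simp add: sum.If_cases Int_absorb1 x_def sum_distrib_left)
    finally show ?thesis using conjugate_square_positive[of x] by simp
  qed
  ultimately show ?thesis using W unfolding psd_def by simp
qed

text \<open>Only the term whose first factor is nonzero at the block of \<open>(r, s)\<close>
  survives. The matrix unit inside \<open>E\<close> has its indices in reversed order.\<close>

lemma cj_matrix_index:
  assumes E: "\<And>X. X \<in> carrier_mat d d \<Longrightarrow> E X \<in> carrier_mat d d"
    and rs: "r < d * d" "s < d * d"
  shows "cj_matrix d E $$ (r, s) = E (ketbra d (s div d) (r div d)) $$ (r mod d, s mod d)"
proof -
  have lt: "r div d < d" "s div d < d" "r mod d < d" "s mod d < d"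
    using rs by (simp_all only: idx_div_mod_less)
  have Ek: "E (ketbra d l k) \<in> carrier_mat d d" for k l by (rule E) (simp add: ketbra_def)
  then have dims: "dim_row (E (ketbra d l k)) = d" "dim_col (E (ketbra d l k)) = d" for k l
    by (metis carrier_matD)+
  have kb: "ketbra d k l $$ (i, j) = (if i = k \<and> j = l then 1 else 0)"
    "dim_row (ketbra d k l) = d" "dim_col (ketbra d k l) = d" if "i < d" "j < d" for i j k l
    using that by (simp_all add: ketbra_def)
  have "(case p of (k, l) \<Rightarrow> kron (ketbra d k l) (E (ketbra d l k))) $$ (r, s) =
      (if p = (r div d, s div d) then E (ketbra d (s div d) (r div d)) $$ (r mod d, s mod d) else 0)"
    for p
    using rs lt by (cases p) (auto simp: kron_def dims kb)
  then have "cj_matrix d E $$ (r, s) = (\<Sum>p\<in>{..<d} \<times> {..<d}. if p = (r div d, s div d)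
      then E (ketbra d (s div d) (r div d)) $$ (r mod d, s mod d) else 0)"
    unfolding cj_matrix_def mat_sum_def using rs by simp
  then show ?thesis using lt by simp
qed

text \<open>Transposing the first factor exchanges the block indices and so cancels the reversal in
  the definition of \<open>cj_matrix\<close>: block (k, l) becomes the image of |k><l|, which is the
  corresponding block of \<open>max_entangled\<close>.\<close>

lemma partial_transpose1_cj_matrix:
  assumes E: "\<And>X. X \<in> carrier_mat d d \<Longrightarrow> E X \<in> carrier_mat d d"
  shows "partial_transpose1 d (cj_matrix d E) = ampliation d d E (max_entangled d)"
proof (rule eq_matI)
  fix r s
  assume "r < dim_row (ampliation d d E (max_entangled d))"
    "s < dim_col (ampliation d d E (max_entangled d))"
  then have rs: "r < d * d" "s < d * d" by (simp_all add: ampliation_def)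
  have lt: "r div d < d" "s div d < d" "r mod d < d" "s mod d < d"
    using rs by (simp_all only: idx_div_mod_less)
  have "mat d d (\<lambda>(i, j). max_entangled d $$ (r div d * d + i, s div d * d + j))
      = ketbra d (r div d) (s div d)"
    using lt by (intro eq_matI) (auto simp: max_entangled_def ketbra_def idx_less)
  then show "partial_transpose1 d (cj_matrix d E) $$ (r, s) = ampliation d d E (max_entangled d) $$ (r, s)"
    using rs lt by (simp add: partial_transpose1_def ampliation_def cj_matrix_index[OF E] idx_less)
qed (simp_all add: partial_transpose1_def ampliation_def)

text \<open>Complete positivity is applied with an ancilla of the same dimension \<open>d\<close>,
  at the maximally entangled operator.\<close>

lemma cptp_psd_partial_transpose1_cj_matrix:
  assumes "cptp d E"
  shows "psd (partial_transpose1 d (cj_matrix d E))"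
proof -
  have "max_entangled d \<in> carrier_mat (d * d) (d * d)" by (simp add: max_entangled_def)
  moreover have "E X \<in> carrier_mat d d" if "X \<in> carrier_mat d d" for X
    using assms that by (simp add: cptp_def linear_map_on_ops_def)
  ultimately show ?thesis
    using assms psd_max_entangled
    by (simp add: partial_transpose1_cj_matrix cptp_def completely_positive_def)
qed

section \<open>Consistency with the forward time flow\<close>

lemma consistent_forward_imp_psd:
  assumes cons: "consistent_forward d Q" and rank: "vec_space.rank d (partial_trace2 d Q) = d"
    and Q: "Q \<in> carrier_mat (d * d) (d * d)"
    and M: "M \<in> carrier_mat (d * d) (d * d)" "Q = sym_prod d (partial_trace2 d Q) M"
  shows "psd (partial_transpose1 d M)"
proof -
  obtain E where E: "cptp d E" "Q = sym_prod d (partial_trace2 d Q) (cj_matrix d E)"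
    using cons by (auto simp: consistent_forward_def)
  have "partial_trace2 d Q \<in> carrier_mat d d" "psd (partial_trace2 d Q)"
    using cons by (auto simp: consistent_forward_def density_matrix_def)
  moreover have "cj_matrix d E \<in> carrier_mat (d * d) (d * d)"
    by (simp add: cj_matrix_def mat_sum_def)
  \<comment> \<open>Both matrices solve the same equation for \<open>Q\<close>, whose marginal has
    full rank.\<close>
  ultimately have "M = cj_matrix d E"
    using sym_prod_ex1[of "partial_trace2 d Q" d Q] rank Q M E by blast
  then show ?thesis using cptp_psd_partial_transpose1_cj_matrix[OF E(1)] by simp
qed

theorem theorem1:
  fixes n :: nat and c :: "nat \<Rightarrow> nat \<Rightarrow> real"
    and R Rbar \<rho> \<gamma> :: "complex mat"
  assumes "n \<ge> 1"
    and "R = pdm n c" and "Rbar = pdm_rev n c"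
    and "\<rho> = partial_trace2 (2 ^ n) R" and "\<gamma> = partial_trace1 (2 ^ n) R"
    and "density_matrix (2 ^ n) \<rho>" and "density_matrix (2 ^ n) \<gamma>"
    and "consistent_forward (2 ^ n) R \<or> consistent_forward (2 ^ n) Rbar"
    and "vec_space.rank (2 ^ n) \<rho> = 2 ^ n" and "vec_space.rank (2 ^ n) \<gamma> = 2 ^ n"
  shows "(\<exists>!M. M \<in> carrier_mat (2 ^ n * 2 ^ n) (2 ^ n * 2 ^ n) \<and> R = sym_prod (2 ^ n) \<rho> M) \<and>
    (\<exists>!Mbar. Mbar \<in> carrier_mat (2 ^ n * 2 ^ n) (2 ^ n * 2 ^ n) \<and>
       Rbar = sym_prod (2 ^ n) \<gamma> Mbar) \<and>
    (\<forall>M \<in> carrier_mat (2 ^ n * 2 ^ n) (2 ^ n * 2 ^ n).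
     \<forall>Mbar \<in> carrier_mat (2 ^ n * 2 ^ n) (2 ^ n * 2 ^ n).
       R = sym_prod (2 ^ n) \<rho> M \<longrightarrow> Rbar = sym_prod (2 ^ n) \<gamma> Mbar \<longrightarrow>
       psd (partial_transpose1 (2 ^ n) M) \<longrightarrow> \<not> psd (partial_transpose1 (2 ^ n) Mbar) \<longrightarrow>
       consistent_forward (2 ^ n) R \<and> \<not> consistent_forward (2 ^ n) Rbar)"
proof (intro conjI ballI impI)
  let ?d = "2 ^ n :: nat"
  have carr: "R \<in> carrier_mat (?d * ?d) (?d * ?d)" "Rbar \<in> carrier_mat (?d * ?d) (?d * ?d)"
    using assms(2,3) by (simp_all add: pdm_def pdm_rev_def mat_sum_def)
  \<comment> \<open>In this form \<gamma> is the initial state of the reversed order, as forward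
    consistency of \<open>Rbar\<close> requires.\<close>
  have \<gamma>: "\<gamma> = partial_trace2 ?d Rbar"
    using assms(2,3,5) by (simp add: partial_trace1_pdm)
  show "\<exists>!M. M \<in> carrier_mat (?d * ?d) (?d * ?d) \<and> R = sym_prod ?d \<rho> M"
    "\<exists>!Mbar. Mbar \<in> carrier_mat (?d * ?d) (?d * ?d) \<and> Rbar = sym_prod ?d \<gamma> Mbar"
    using assms(6,7) sym_prod_ex1[OF _ _ assms(9) carr(1)] sym_prod_ex1[OF _ _ assms(10) carr(2)]
    unfolding density_matrix_def by blast+
  fix M Mbar
  assume "Mbar \<in> carrier_mat (?d * ?d) (?d * ?d)" "Rbar = sym_prod ?d \<gamma> Mbar"
    "\<not> psd (partial_transpose1 ?d Mbar)"
  then show "\<not> consistent_forward ?d Rbar"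
    using consistent_forward_imp_psd[of ?d Rbar Mbar] carr(2) assms(10) unfolding \<gamma> by blast
  then show "consistent_forward ?d R" using assms(8) by blast
qed

end
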